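(* Let $c$ be a real number with $c \geq \sqrt{6}$. Then it is not true that every connected triangle-free graph $G$ with $n$ vertices and $m$ edges and $G \not\cong C_5$ satisfies $$\chi(G) \leq \left\lceil \frac{m}{c\sqrt{n}} \right\rceil + 1.$$ Indeed, the graph $G$ obtained from the cycle $C_5$ by attaching one pendant vertex (a new vertex adjacent to exactly one vertex of the cycle) is connected and triangle-free with $n = m = 6$ and $\chi(G) = 3$, while $\left\lceil \frac{6}{c\sqrt{6}} \right\rceil + 1 = 2$ for every $c \geq \sqrt{6}$.
   Context: All graphs are finite and simple (no loops, no multiple edges). $\chi(G)$ denotes the (vertex) chromatic number of $G$. A graph is triangle-free if it contains no $K_3$ as a subgraph. $C_\ell$ denotes the cycle of length $\ell$. *)

theory Defs
  imports Complex_Main "Graph_Theory.Graph_Theory"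
begin

text \<open>
  A finite simple graph is a \<^locale>\<open>pair_graph\<close>: a finite, loop-free, symmetric digraph whose
  arcs are pairs of vertices. An edge \<open>uv\<close> is represented by the two arcs \<open>(u, v)\<close> and \<open>(v, u)\<close>,
  so edges are counted as unordered pairs.
\<close>

definition num_edges :: "'a pair_pre_digraph \<Rightarrow> nat" where
  "num_edges G = card ((\<lambda>(u, v). {u, v}) ` parcs G)"

definition triangle_free :: "'a pair_pre_digraph \<Rightarrow> bool" where
  "triangle_free G \<longleftrightarrow> \<not> (\<exists>H. subgraph H (with_proj G) \<and> complete_digraph 3 H)"

definition proper_colouring :: "'a pair_pre_digraph \<Rightarrow> nat \<Rightarrow> ('a \<Rightarrow> nat) \<Rightarrow> bool" where
  "proper_colouring G k f \<longleftrightarrow>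
     (\<forall>v \<in> pverts G. f v < k) \<and> (\<forall>(u, v) \<in> parcs G. f u \<noteq> f v)"

definition chromatic_number :: "'a pair_pre_digraph \<Rightarrow> nat" where
  "chromatic_number G = (LEAST k. \<exists>f. proper_colouring G k f)"

text \<open>The cycle \<open>C\<^sub>l\<close> on the vertices \<open>0, \<dots>, l - 1\<close>, meaningful for \<open>l \<ge> 3\<close>.\<close>

definition cycle_graph :: "nat \<Rightarrow> nat pair_pre_digraph" where
  "cycle_graph l =
     \<lparr> pverts = {..<l},
       parcs = {(u, v). u < l \<and> v < l \<and> (v = (u + 1) mod l \<or> u = (v + 1) mod l)} \<rparr>"

text \<open>\<open>w\<close> is the new vertex, adjacent to \<open>v\<close> only; intended for \<open>v \<in> pverts G\<close>, \<open>w \<notin> pverts G\<close>.\<close>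

definition attach_pendant :: "'a pair_pre_digraph \<Rightarrow> 'a \<Rightarrow> 'a \<Rightarrow> 'a pair_pre_digraph" where
  "attach_pendant G v w =
     \<lparr> pverts = insert w (pverts G), parcs = parcs G \<union> {(v, w), (w, v)} \<rparr>"

end

theory Submission
  imports Defs
begin

text \<open>
  The counterexample is \<open>C\<^sub>5\<close> with a pendant vertex. For \<open>n = m = 6\<close> and \<open>c \<ge> sqrt 6\<close> the
  quotient \<open>m / (c * sqrt n)\<close> lies in \<open>(0, 1]\<close>, so the bound is \<open>2\<close>, whereas a graph that
  contains an odd cycle needs three colours.

  The properties of the counterexample split along its construction. Attaching a pendant vertex
  keeps a graph simple, connected and triangle-free, adds one vertex and one edge, and does not
  affect colourability with two or more colours, since the new vertex only has to avoid the colour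
  of its single neighbour (\<open>pendant_colourable_iff\<close>). This leaves the cycle \<open>C\<^sub>l\<close>: it is
  triangle-free for \<open>l \<ge> 4\<close>, has \<open>l\<close> edges for \<open>l \<ge> 3\<close>, and for odd \<open>l \<ge> 3\<close> it is colourable with
  three colours but not with two, because two colours would have to alternate along the cycle
  and clash where it closes up. Finally the counterexample is not the excepted graph \<open>C\<^sub>5\<close>, as
  it has six vertices.
\<close>

section \<open>Triangles, connectedness and colourings\<close>

lemma pair_graphI:
  assumes "finite (pverts G)" "parcs G \<subseteq> pverts G \<times> pverts G" "sym (parcs G)"
    "\<And>u. (u, u) \<notin> parcs G"
  shows "pair_graph G"
proof -
  have "finite (parcs G)"
    using assms(1) by (intro finite_subset[OF assms(2)]) simp
  with assms show ?thesis
    by unfold_locales (auto simp: symmetric_def)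
qed

text \<open>A subgraph \<open>K\<^sub>3\<close> is the same as three pairwise adjacent vertices; this form is the one in which
  concrete graphs can be checked.\<close>

lemma triangle_free_iff:
  assumes "pair_graph G"
  shows "triangle_free G \<longleftrightarrow>
    \<not> (\<exists>x y z. (x, y) \<in> parcs G \<and> (y, z) \<in> parcs G \<and> (x, z) \<in> parcs G)"
proof -
  interpret pair_graph G by fact
  have "\<exists>H. subgraph H (with_proj G) \<and> complete_digraph 3 H"
    if xyz: "(x, y) \<in> parcs G" "(y, z) \<in> parcs G" "(x, z) \<in> parcs G" for x y z
  proof (intro exI conjI)
    let ?T = "\<lparr>pverts = {x, y, z}, parcs = {(u, v). u \<in> {x, y, z} \<and> v \<in> {x, y, z} \<and> u \<noteq> v}\<rparr>"
    have "x \<noteq> y" "y \<noteq> z" "x \<noteq> z"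
      using xyz no_loops' by blast+
    then show complete: "complete_digraph 3 (with_proj ?T)"
      by (auto simp: complete_digraph_pair_def)
    have "wf_digraph (with_proj ?T)"
      by unfold_locales auto
    moreover have "parcs ?T \<subseteq> parcs G"
      using xyz arcs_symmetric by auto
    moreover have "pverts ?T \<subseteq> pverts G"
      using xyz in_arcsD1 in_arcsD2 by auto
    ultimately show "subgraph (with_proj ?T) (with_proj G)"
      by (simp add: subgraph_def compatible_def wf_digraph_axioms)
  qed
  moreover have "\<exists>x y z. (x, y) \<in> parcs G \<and> (y, z) \<in> parcs G \<and> (x, z) \<in> parcs G"
    if sub: "subgraph H (with_proj G)" and complete: "complete_digraph 3 H" for H
  proof -
    have "card (verts H) = 3"
      and ends: "arcs_ends H = {(u, v). (u, v) \<in> verts H \<times> verts H \<and> u \<noteq> v}"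
      using complete by (simp_all add: complete_digraph_def)
    then obtain x y z where "verts H = {x, y, z}" "x \<noteq> y" "y \<noteq> z" "x \<noteq> z"
      by (auto simp: card_3_iff)
    moreover from sub have "arcs_ends H \<subseteq> parcs G"
      by (auto simp: subgraph_def compatible_def arcs_ends_def arc_to_ends_def)
    ultimately show ?thesis
      using ends by blast
  qed
  ultimately show ?thesis
    unfolding triangle_free_def by blast
qed

lemma connectedI_root:
  assumes "r \<in> verts G"
    and root: "\<And>u. u \<in> verts G \<Longrightarrow> (r, u) \<in> rtrancl_on (verts G) ((arcs_ends G)\<^sup>s)"
  shows "Digraph_Component.connected G"
proof -
  have "sym ((arcs_ends G)\<^sup>s)"
    by (auto simp: symcl_def sym_def)
  then have "sym (rtrancl_on (verts G) ((arcs_ends G)\<^sup>s))"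
    by (rule rtrancl_on_sym)
  then have "(u, v) \<in> rtrancl_on (verts G) ((arcs_ends G)\<^sup>s)"
    if "u \<in> verts G" "v \<in> verts G" for u v
    using root[OF that(1)] root[OF that(2)] by (meson rtrancl_on_trans symD)
  with assms(1) show ?thesis
    by (auto simp: connected_conv)
qed

lemma proper_colouring_mono:
  "proper_colouring G k f \<Longrightarrow> k \<le> k' \<Longrightarrow> proper_colouring G k' f"
  by (auto simp: proper_colouring_def)

lemma chromatic_number_eqI:
  assumes "proper_colouring G (Suc k) f" "\<And>g. \<not> proper_colouring G k g"
  shows "chromatic_number G = Suc k"
  unfolding chromatic_number_def
proof (rule Least_equality)
  show "\<exists>f. proper_colouring G (Suc k) f"
    using assms(1) by blast
  show "Suc k \<le> j" if "\<exists>f. proper_colouring G j f" for j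
    using that assms(2) proper_colouring_mono by (meson not_less_eq_eq)
qed

section \<open>Attaching a pendant vertex\<close>

lemma attach_pendant_simps [simp]:
  "pverts (attach_pendant G v w) = insert w (pverts G)"
  "parcs (attach_pendant G v w) = parcs G \<union> {(v, w), (w, v)}"
  by (simp_all add: attach_pendant_def)

context pair_graph
begin

lemma pair_graph_attach_pendant:
  assumes "v \<in> pverts G" "w \<notin> pverts G"
  shows "pair_graph (attach_pendant G v w)"
proof (rule pair_graphI)
  show "finite (pverts (attach_pendant G v w))"
    using pair_finite_verts by simp
  show "parcs (attach_pendant G v w) \<subseteq> pverts (attach_pendant G v w) \<times> pverts (attach_pendant G v w)"
    using assms in_arcsD1 in_arcsD2 by auto
  show "sym (parcs (attach_pendant G v w))"
    using arcs_symmetric by (auto intro!: symI)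
  show "(u, u) \<notin> parcs (attach_pendant G v w)" for u
    using assms no_loops' by auto
qed

lemma connected_attach_pendant:
  assumes "v \<in> pverts G" "Digraph_Component.connected (with_proj G)"
  shows "Digraph_Component.connected (with_proj (attach_pendant G v w))"
proof (rule connectedI_root)
  let ?V = "insert w (pverts G)" and ?A = "parcs G \<union> {(v, w), (w, v)}"
  show "v \<in> verts (with_proj (attach_pendant G v w))"
    using assms by simp
  have "(v, u) \<in> rtrancl_on ?V (?A\<^sup>s)" if "u \<in> ?V" for u
  proof (cases "u \<in> pverts G")
    case True
    then have "(v, u) \<in> rtrancl_on (pverts G) ((parcs G)\<^sup>s)"
      using assms by (simp add: connected_conv)
    then show ?thesis
      by (rule rtrancl_on_mono[rotated 2]) (auto simp: symcl_def)
  next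
    case False
    then have "u = w" using that by simp
    moreover have "(v, v) \<in> rtrancl_on ?V (?A\<^sup>s)"
      using assms by auto
    ultimately show ?thesis
      by (auto intro: rtrancl_on_into_rtrancl_on simp: symcl_def)
  qed
  then show "(v, u) \<in> rtrancl_on (verts (with_proj (attach_pendant G v w)))
      ((arcs_ends (with_proj (attach_pendant G v w)))\<^sup>s)"
    if "u \<in> verts (with_proj (attach_pendant G v w))" for u
    using that by simp
qed

text \<open>A triangle through the new vertex would give it two distinct neighbours.\<close>

lemma triangle_free_attach_pendant:
  assumes "v \<in> pverts G" "w \<notin> pverts G" "triangle_free G"
  shows "triangle_free (attach_pendant G v w)"
proof -
  have "\<And>u. (u, w) \<notin> parcs G" "\<And>u. (w, u) \<notin> parcs G" "\<And>u. (u, u) \<notin> parcs G"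
    using assms in_arcsD1 in_arcsD2 no_loops' by blast+
  moreover have "v \<noteq> w"
    using assms by auto
  ultimately show ?thesis
    using assms(3)
    unfolding triangle_free_iff[OF pair_graph_attach_pendant[OF assms(1,2)]]
      triangle_free_iff[OF pair_graph]
    by auto
qed

lemma num_edges_attach_pendant:
  assumes "w \<notin> pverts G"
  shows "num_edges (attach_pendant G v w) = Suc (num_edges G)"
proof -
  let ?E = "(\<lambda>(u, v). {u, v}) ` parcs G"
  have "{v, w} \<notin> ?E"
    using assms in_arcsD1 in_arcsD2 by (auto simp: doubleton_eq_iff)
  moreover have "(\<lambda>(u, v). {u, v}) ` parcs (attach_pendant G v w) = insert {v, w} ?E"
    by (auto simp: image_Un)
  ultimately show ?thesis
    using pair_finite_arcs by (simp add: num_edges_def)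
qed

text \<open>One colour is not enough: the new edge needs two even if \<open>G\<close> has no arcs.\<close>

lemma pendant_colourable_iff:
  assumes "v \<in> pverts G" "w \<notin> pverts G" "2 \<le> k"
  shows "(\<exists>f. proper_colouring (attach_pendant G v w) k f) \<longleftrightarrow> (\<exists>f. proper_colouring G k f)"
proof
  assume "\<exists>f. proper_colouring (attach_pendant G v w) k f"
  then show "\<exists>f. proper_colouring G k f"
    by (auto simp: proper_colouring_def)
next
  assume "\<exists>f. proper_colouring G k f"
  then obtain f where f: "proper_colouring G k f" ..
  define a :: nat where "a = (if f v = 0 then 1 else 0)"
  have "a < k" "a \<noteq> f v"
    using assms(3) by (auto simp: a_def)
  moreover have "x \<noteq> w \<and> y \<noteq> w" if "(x, y) \<in> parcs G" for x y
    using that assms(2) in_arcsD1 in_arcsD2 by blast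
  ultimately have "proper_colouring (attach_pendant G v w) k (f(w := a))"
    using f assms(1,2) by (fastforce simp: proper_colouring_def)
  then show "\<exists>f. proper_colouring (attach_pendant G v w) k f"
    by blast
qed

end

section \<open>Cycles\<close>

lemma cycle_graph_simps [simp]:
  "pverts (cycle_graph l) = {..<l}"
  "(u, v) \<in> parcs (cycle_graph l) \<longleftrightarrow>
    u < l \<and> v < l \<and> (v = Suc u mod l \<or> u = Suc v mod l)"
  by (simp_all add: cycle_graph_def)

lemma Suc_mod_less:
  "u < l \<Longrightarrow> Suc u mod l = (if Suc u = l then 0 else Suc u)" for l :: nat
  by auto

lemma pair_graph_cycle_graph:
  assumes "2 \<le> l"
  shows "pair_graph (cycle_graph l)"
proof (rule pair_graphI)
  show "parcs (cycle_graph l) \<subseteq> pverts (cycle_graph l) \<times> pverts (cycle_graph l)"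
    by auto
  show "sym (parcs (cycle_graph l))"
    by (auto intro!: symI)
  show "(u, u) \<notin> parcs (cycle_graph l)" for u
    using assms by (auto simp: Suc_mod_less split: if_splits)
qed simp

lemma connected_cycle_graph:
  assumes "0 < l"
  shows "Digraph_Component.connected (with_proj (cycle_graph l))"
proof (rule connectedI_root)
  show "0 \<in> verts (with_proj (cycle_graph l))"
    using assms by simp
  have "(0, u) \<in> rtrancl_on {..<l} ((parcs (cycle_graph l))\<^sup>s)" if "u < l" for u
    using that
  proof (induction u)
    case (Suc u)
    then have "(u, Suc u) \<in> (parcs (cycle_graph l))\<^sup>s"
      by (simp add: symcl_def)
    with Suc show ?case
      by (auto intro: rtrancl_on_into_rtrancl_on)
  qed auto
  then show "(0, u) \<in> rtrancl_on (verts (with_proj (cycle_graph l)))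
      ((arcs_ends (with_proj (cycle_graph l)))\<^sup>s)"
    if "u \<in> verts (with_proj (cycle_graph l))" for u
    using that by simp
qed

lemma triangle_free_cycle_graph:
  assumes "4 \<le> l"
  shows "triangle_free (cycle_graph l)"
proof -
  have "pair_graph (cycle_graph l)"
    using assms by (intro pair_graph_cycle_graph) simp
  then show ?thesis
    using assms by (auto simp: triangle_free_iff Suc_mod_less split: if_splits)
qed

text \<open>Sending \<open>u\<close> to the edge from \<open>u\<close> to its successor enumerates the edges; for \<open>l = 2\<close> both
  vertices would give the same edge.\<close>

lemma num_edges_cycle_graph:
  assumes "3 \<le> l"
  shows "num_edges (cycle_graph l) = l"
proof -
  let ?e = "\<lambda>u. {u, Suc u mod l}"
  have "(\<lambda>(u, v). {u, v}) ` parcs (cycle_graph l) = ?e ` {..<l}"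
  proof (intro equalityI subsetI)
    fix e assume "e \<in> (\<lambda>(u, v). {u, v}) ` parcs (cycle_graph l)"
    then obtain u v where e: "e = {u, v}" and "u < l" "v < l" "v = Suc u mod l \<or> u = Suc v mod l"
      by auto
    then have "e = ?e u \<or> e = ?e v"
      by auto
    with \<open>u < l\<close> \<open>v < l\<close> show "e \<in> ?e ` {..<l}"
      by blast
  next
    fix e assume "e \<in> ?e ` {..<l}"
    then obtain u where "u < l" "e = ?e u"
      by auto
    then show "e \<in> (\<lambda>(u, v). {u, v}) ` parcs (cycle_graph l)"
      by (intro image_eqI[of _ _ "(u, Suc u mod l)"]) auto
  qed
  moreover have "inj_on ?e {..<l}"
    using assms by (auto simp: inj_on_def doubleton_eq_iff Suc_mod_less split: if_splits)
  ultimately show ?thesis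
    by (simp add: num_edges_def card_image)
qed

text \<open>With two colours, adjacent vertices force the colour of \<open>u\<close> to be that of \<open>0\<close> shifted by the
  parity of \<open>u\<close>; for odd \<open>l\<close> the last vertex \<open>l - 1\<close> then has the colour of its neighbour \<open>0\<close>.\<close>

lemma odd_cycle_not_2_colourable:
  assumes "odd l"
  shows "\<not> proper_colouring (cycle_graph l) 2 f"
proof
  assume f: "proper_colouring (cycle_graph l) 2 f"
  have range: "f u < 2" if "u < l" for u
    using f that by (auto simp: proper_colouring_def)
  have adjacent: "f u \<noteq> f v" if "(u, v) \<in> parcs (cycle_graph l)" for u v
    using f that unfolding proper_colouring_def by blast
  have alternate: "f u = (f 0 + u) mod 2" if "u < l" for u
    using that
  proof (induction u)
    case 0
    then show ?case using range[of 0] by simp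
  next
    case (Suc u)
    then have "f u \<noteq> f (Suc u)"
      by (intro adjacent) simp
    with Suc range[of "Suc u"] show ?case
      by simp presburger
  qed
  have "f (l - 1) = f 0"
    using assms alternate[of "l - 1"] range[of 0] by (auto elim!: oddE)
  moreover have "f (l - 1) \<noteq> f 0"
    using assms by (intro adjacent) (auto simp: odd_pos)
  ultimately show False
    by simp
qed

text \<open>The third colour is spent on the last vertex only; the remaining path takes alternating
  colours.\<close>

lemma cycle_3_colouring:
  assumes "2 \<le> l"
  shows "proper_colouring (cycle_graph l) 3 (\<lambda>u. if Suc u = l then 2 else u mod 2)"
  using assms
  by (auto simp: proper_colouring_def Suc_mod_less mod_Suc split: if_splits)

section \<open>The counterexample\<close>

lemma odd_cycle_with_pendant:
  assumes "odd l" "5 \<le> l" "v < l" "l \<le> w"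
  defines "G \<equiv> attach_pendant (cycle_graph l) v w"
  shows "pair_graph G" "Digraph_Component.connected (with_proj G)" "triangle_free G"
    "card (pverts G) = Suc l" "num_edges G = Suc l" "chromatic_number G = 3"
proof -
  interpret C: pair_graph "cycle_graph l"
    using assms by (intro pair_graph_cycle_graph) simp
  have vw: "v \<in> pverts (cycle_graph l)" "w \<notin> pverts (cycle_graph l)"
    using assms by auto
  show "pair_graph G"
    unfolding G_def using vw by (rule C.pair_graph_attach_pendant)
  show "Digraph_Component.connected (with_proj G)"
    unfolding G_def using assms by (intro C.connected_attach_pendant connected_cycle_graph) auto
  show "triangle_free G"
    unfolding G_def using assms by (intro C.triangle_free_attach_pendant triangle_free_cycle_graph) auto
  show "card (pverts G) = Suc l"
    using assms by (simp add: G_def)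
  show "num_edges G = Suc l"
    unfolding G_def using assms vw by (simp add: C.num_edges_attach_pendant num_edges_cycle_graph)
  have "\<exists>f. proper_colouring G 3 f"
    unfolding G_def using assms cycle_3_colouring[of l] by (subst C.pendant_colourable_iff) auto
  moreover have "\<nexists>f. proper_colouring G 2 f"
    unfolding G_def using assms odd_cycle_not_2_colourable[of l]
    by (subst C.pendant_colourable_iff) auto
  ultimately show "chromatic_number G = 3"
    using chromatic_number_eqI[of G 2] by (auto simp: numeral_3_eq_3 numeral_2_eq_2)
qed

lemma digraph_iso_card_verts:
  assumes "digraph_iso G H"
  shows "card (verts G) = card (verts H)"
  using assms
  by (auto simp: digraph_iso_def pre_digraph.digraph_isomorphism_def card_image)

lemma bound_eq_2:
  fixes c :: real
  assumes "c \<ge> sqrt 6"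
  shows "\<lceil>6 / (c * sqrt 6)\<rceil> + 1 = 2"
proof -
  have "6 = sqrt 6 * sqrt 6"
    by simp
  also have "\<dots> \<le> c * sqrt 6"
    using assms by (intro mult_right_mono) auto
  finally have "6 \<le> c * sqrt 6" .
  then have "0 < 6 / (c * sqrt 6)" "6 / (c * sqrt 6) \<le> 1"
    by auto
  then have "\<lceil>6 / (c * sqrt 6)\<rceil> = 1"
    by (intro ceiling_unique) auto
  then show ?thesis
    by simp
qed

theorem mainTheorem4:
  fixes c :: real
  assumes "c \<ge> sqrt 6"
  shows "\<not> (\<forall>G :: nat pair_pre_digraph.
            pair_graph G \<and> Digraph_Component.connected (with_proj G) \<and> triangle_free G \<and>
            \<not> digraph_iso (with_proj G) (with_proj (cycle_graph 5)) \<longrightarrow>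
            int (chromatic_number G) \<le>
              \<lceil>real (num_edges G) / (c * sqrt (real (card (pverts G))))\<rceil> + 1)
       \<and> (\<forall>v w. v \<in> pverts (cycle_graph 5) \<and> w \<notin> pverts (cycle_graph 5) \<longrightarrow>
           (let G = attach_pendant (cycle_graph 5) v w in
            pair_graph G \<and> Digraph_Component.connected (with_proj G) \<and> triangle_free G \<and>
            card (pverts G) = 6 \<and> num_edges G = 6 \<and> chromatic_number G = 3))
       \<and> \<lceil>6 / (c * sqrt 6)\<rceil> + 1 = 2"
proof -
  have pendant: "let G = attach_pendant (cycle_graph 5) v w in
      pair_graph G \<and> Digraph_Component.connected (with_proj G) \<and> triangle_free G \<and>
      card (pverts G) = 6 \<and> num_edges G = 6 \<and> chromatic_number G = 3"
    if "v \<in> pverts (cycle_graph 5)" "w \<notin> pverts (cycle_graph 5)" for v w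
  proof -
    have "odd (5::nat)" "(5::nat) \<le> 5" "v < 5" "5 \<le> w"
      using that by auto
    from odd_cycle_with_pendant[OF this] show ?thesis
      by (simp add: Let_def del: attach_pendant_simps)
  qed
  define G where "G = attach_pendant (cycle_graph 5) 0 5"
  have G: "pair_graph G" "Digraph_Component.connected (with_proj G)" "triangle_free G"
    "card (pverts G) = 6" "num_edges G = 6" "chromatic_number G = 3"
    using pendant[of 0 5] by (simp_all add: Let_def G_def del: attach_pendant_simps)
  moreover have "\<not> digraph_iso (with_proj G) (with_proj (cycle_graph 5))"
    using digraph_iso_card_verts[of "with_proj G" "with_proj (cycle_graph 5)"] G(4) by auto
  moreover have "\<not> int (chromatic_number G) \<le>
      \<lceil>real (num_edges G) / (c * sqrt (real (card (pverts G))))\<rceil> + 1"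
    using G(4-6) bound_eq_2[OF assms] by simp
  ultimately show ?thesis
    using pendant bound_eq_2[OF assms] by blast
qed

end
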